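(* Let $\alpha\in(0,1)$ and let $\mathcal{Q}$ be a countable question space. For each $i=1,2,\ldots$, research group $i$ collects data $Y_i\sim F_i$, where $Y_1,Y_2,\ldots$ are independent; it applies a selection rule $\widehat{\mathcal{Q}}_i(Y_i)\subseteq\mathcal{Q}$ and carries out selective level-$\alpha$ tests $\phi_{q,i}(Y_i)$ for all $q\in\widehat{\mathcal{Q}}_i(Y_i)$. Assume that there is a $\delta>0$ such that each research group has probability at least $\delta$ of carrying out at least one test of a true null, i.e. $\mathbb{P}_{F_i}\big(\exists q\in\widehat{\mathcal{Q}}_i(Y_i):\,F_i\in H_0(q)\big)\ge\delta$ for all $i$, and that for some common $B<\infty$, $$\mathbb{E}_{F_i}\left[|\widehat{\mathcal{Q}}_i(Y_i)|^2\right]\le B\quad\text{for all } i.$$ Let $R_i$ be the number of true nulls selected by group $i$ and $V_i$ the number of false rejections made by group $i$. Then $$\limsup_{n\to\infty}\frac{\sum_{i=1}^n V_i}{\sum_{i=1}^n R_i}\le\alpha\quad\text{almost surely.}$$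
   Context: A question (hypothesis testing problem) is a pair $q=(M(q),H_0(q))$ of a model $M(q)$ (a family of probability distributions on the sample space) and a null hypothesis $H_0(q)\subseteq M(q)$. For group $i$ the selection event of $q$ is $A_{q,i}=\{q\in\widehat{\mathcal{Q}}_i(Y_i)\}$ (assumed measurable). A test is a measurable function $\phi$ with values in $[0,1]$, $\phi(y)$ being the (conditional) probability of rejecting when the data equal $y$. The test $\phi_{q,i}$ is a selective level-$\alpha$ test if $\mathbb{E}_F[\phi_{q,i}(Y_i)\mid A_{q,i}]\le\alpha$ for all $F\in H_0(q)$ with $\mathbb{P}_F(A_{q,i})>0$. A true null selected by group $i$ is a $q\in\widehat{\mathcal{Q}}_i(Y_i)$ with $F_i\in H_0(q)$, so $R_i=|\{q\in\widehat{\mathcal{Q}}_i(Y_i):F_i\in H_0(q)\}|$; a false rejection is a selected true null which is rejected by its test, and $V_i$ is the number of these. If tests are randomized, a selected $q$ is rejected with conditional probability $\phi_{q,i}(Y_i)$ given $Y_i$, and the groups (including any auxiliary randomization) operate independently of each other. *)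

theory Defs
  imports "HOL-Probability.Probability"
begin

type_synonym 'y question = "'y measure set \<times> 'y measure set"

abbreviation model :: "'y question \<Rightarrow> 'y measure set" where
  "model \<equiv> fst"

abbreviation null_hyp :: "'y question \<Rightarrow> 'y measure set" where
  "null_hyp \<equiv> snd"

definition is_question :: "'y measure \<Rightarrow> 'y question \<Rightarrow> bool" where
  "is_question S q \<longleftrightarrow>
     model q \<subseteq> {F. prob_space F \<and> sets F = sets S} \<and> null_hyp q \<subseteq> model q"

definition selection_event ::
    "'y measure \<Rightarrow> ('y \<Rightarrow> 'y question set) \<Rightarrow> 'y question \<Rightarrow> 'y set" where
  "selection_event S Qhat q = {y \<in> space S. q \<in> Qhat y}"

text \<open>A selection rule may select infinitely many questions at some data values.\<close>

definition is_selection_rule ::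
    "'y measure \<Rightarrow> 'y question set \<Rightarrow> ('y \<Rightarrow> 'y question set) \<Rightarrow> bool" where
  "is_selection_rule S Q Qhat \<longleftrightarrow>
     (\<forall>y \<in> space S. Qhat y \<subseteq> Q) \<and> (\<forall>q \<in> Q. selection_event S Qhat q \<in> sets S)"

definition is_test :: "'y measure \<Rightarrow> ('y \<Rightarrow> real) \<Rightarrow> bool" where
  "is_test S \<phi> \<longleftrightarrow> \<phi> \<in> borel_measurable S \<and> (\<forall>y \<in> space S. 0 \<le> \<phi> y \<and> \<phi> y \<le> 1)"

text \<open>Conditional expectation given an event of positive probability.\<close>

definition event_cond_exp :: "'y measure \<Rightarrow> ('y \<Rightarrow> real) \<Rightarrow> 'y set \<Rightarrow> real" where
  "event_cond_exp F f A = (LINT y:A|F. f y) / measure F A"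

definition selective_level_test ::
    "real \<Rightarrow> 'y measure \<Rightarrow> ('y \<Rightarrow> 'y question set) \<Rightarrow> 'y question \<Rightarrow> ('y \<Rightarrow> real) \<Rightarrow> bool" where
  "selective_level_test \<alpha> S Qhat q \<phi> \<longleftrightarrow>
     is_test S \<phi> \<and>
     (\<forall>F \<in> null_hyp q. measure F (selection_event S Qhat q) > 0 \<longrightarrow>
        event_cond_exp F \<phi> (selection_event S Qhat q) \<le> \<alpha>)"

text \<open>
  The set of tests that reject may depend on more than the data, since tests can be randomized:
  \<open>Rej \<omega>\<close> is the set of rejected questions. Given the data \<open>Y\<close>, a selected question \<open>q\<close> is rejected
  with conditional probability \<open>\<phi> q (Y \<omega>)\<close>. The joint law of the rejections of different
  questions given the data is left unrestricted, as is the behaviour of \<open>Rej\<close> on questions that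
  have not been selected. For nonrandomized tests \<open>q \<in> Rej \<omega>\<close> amounts to \<open>\<phi> q (Y \<omega>) = 1\<close>.
\<close>

definition rejects_according_to ::
    "'w measure \<Rightarrow> 'y measure \<Rightarrow> 'y question set \<Rightarrow> ('y \<Rightarrow> 'y question set) \<Rightarrow>
     ('y question \<Rightarrow> 'y \<Rightarrow> real) \<Rightarrow> ('w \<Rightarrow> 'y) \<Rightarrow> ('w \<Rightarrow> 'y question set) \<Rightarrow> bool" where
  "rejects_according_to M S Q Qhat \<phi> Y Rej \<longleftrightarrow>
     (\<forall>q \<in> Q. {\<omega> \<in> space M. q \<in> Rej \<omega>} \<in> sets M \<and>
        (AE \<omega> in M. q \<in> Qhat (Y \<omega>) \<longrightarrow>
           real_cond_exp M (vimage_algebra (space M) Y S)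
             (indicator {\<omega> \<in> space M. q \<in> Rej \<omega>}) \<omega> = \<phi> q (Y \<omega>)))"

text \<open>
  Everything a group observes or decides, as one random element: its data together with the
  family of its rejection indicators, valued in the following measurable space.
\<close>

definition group_space :: "'y measure \<Rightarrow> 'y question set \<Rightarrow> ('y \<times> ('y question \<Rightarrow> bool)) measure" where
  "group_space S Q = S \<Otimes>\<^sub>M (\<Pi>\<^sub>M q\<in>Q. count_space UNIV)"

definition group_outcome ::
    "'y question set \<Rightarrow> ('w \<Rightarrow> 'y) \<Rightarrow> ('w \<Rightarrow> 'y question set) \<Rightarrow> 'w \<Rightarrow> 'y \<times> ('y question \<Rightarrow> bool)" where
  "group_outcome Q Y Rej \<omega> = (Y \<omega>, \<lambda>q\<in>Q. q \<in> Rej \<omega>)"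

text \<open>
  The counts below use \<open>card\<close>, which is 0 on infinite sets; when the number of selected questions
  has a finite second moment, infinite sets occur with probability zero only. The second moment
  itself is expressed with \<open>ecard\<close>, which is infinite on infinite sets.
\<close>

definition ecard :: "'a set \<Rightarrow> ennreal" where
  "ecard A = emeasure (count_space UNIV) A"

definition selected_true_nulls ::
    "'y measure \<Rightarrow> ('y \<Rightarrow> 'y question set) \<Rightarrow> 'y \<Rightarrow> 'y question set" where
  "selected_true_nulls F Qhat y = {q \<in> Qhat y. F \<in> null_hyp q}"

definition num_true_nulls ::
    "'y measure \<Rightarrow> ('y \<Rightarrow> 'y question set) \<Rightarrow> ('w \<Rightarrow> 'y) \<Rightarrow> 'w \<Rightarrow> nat" where
  "num_true_nulls F Qhat Y \<omega> = card (selected_true_nulls F Qhat (Y \<omega>))"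

definition num_false_rejections ::
    "'y measure \<Rightarrow> ('y \<Rightarrow> 'y question set) \<Rightarrow> ('w \<Rightarrow> 'y) \<Rightarrow> ('w \<Rightarrow> 'y question set) \<Rightarrow> 'w \<Rightarrow> nat" where
  "num_false_rejections F Qhat Y Rej \<omega> = card (selected_true_nulls F Qhat (Y \<omega>) \<inter> Rej \<omega>)"

end

theory Submission
  imports Defs "HOL-Library.Discrete_Functions"
begin

text \<open>
  Conditioning on the data shows that a selected true null is rejected with probability at most \<open>\<alpha>\<close>
  times its selection probability; summing over the countably many questions gives
  \<open>E V\<^sub>i \<le> \<alpha> E R\<^sub>i\<close>. Since \<open>V\<^sub>i - \<alpha> R\<^sub>i\<close> and \<open>R\<^sub>i\<close> are independent over \<open>i\<close> with bounded second moments,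
  the strong law of large numbers applies to both: almost surely the averages of \<open>V\<^sub>i - \<alpha> R\<^sub>i\<close> have
  nonpositive limsup, while those of \<open>R\<^sub>i\<close> are eventually at least \<open>\<delta> / 2\<close>, as \<open>E R\<^sub>i \<ge> \<delta>\<close>.
\<close>

section \<open>Almost sure convergence of averages\<close>

text \<open>For \<open>m\<close> the integer square root of \<open>n\<close>, the sums up to
  \<open>n\<close> and up to m^2 differ by at most the absolute sum over the block from m^2 to
  (m+1)^2. Since m^2 \<le> n, dividing by m^2 instead of \<open>n\<close> only enlarges the bound,
  so control along the squares and on the blocks suffices.\<close>

lemma average_tendsto_0_if_squares:
  fixes w :: "nat \<Rightarrow> real"
  assumes sq: "(\<lambda>m. (\<Sum>i=1..m\<^sup>2. w i) / real m ^ 2) \<longlonglongrightarrow> 0"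
    and gap: "(\<lambda>m. (\<Sum>i\<in>{m\<^sup>2<..(Suc m)\<^sup>2}. \<bar>w i\<bar>) / real m ^ 2) \<longlonglongrightarrow> 0"
  shows "(\<lambda>n. (\<Sum>i=1..n. w i) / real n) \<longlonglongrightarrow> 0"
proof -
  define a where "a m = \<bar>(\<Sum>i=1..m\<^sup>2. w i) / real m ^ 2\<bar> +
    (\<Sum>i\<in>{m\<^sup>2<..(Suc m)\<^sup>2}. \<bar>w i\<bar>) / real m ^ 2" for m
  have "a \<longlonglongrightarrow> 0"
    unfolding a_def using tendsto_add[OF tendsto_rabs_zero[OF sq] gap] by simp
  moreover have "filterlim floor_sqrt at_top at_top"
    unfolding filterlim_at_top eventually_at_top_linorder by (metis le_floor_sqrtI order_trans)
  ultimately have lim: "(\<lambda>n. a (floor_sqrt n)) \<longlonglongrightarrow> 0"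
    by (rule filterlim_compose)
  have "norm ((\<Sum>i=1..n. w i) / real n) \<le> a (floor_sqrt n)" if n: "n \<ge> 1" for n
  proof -
    define m where "m = floor_sqrt n"
    have m: "m\<^sup>2 \<le> n" "n < (Suc m)\<^sup>2" "m > 0"
      using n Suc_floor_sqrt_power2_gt[of n] by (auto simp: m_def)
    have "{1..n} = {1..m\<^sup>2} \<union> {m\<^sup>2<..n}"
      using m by (auto intro: Suc_leI order_trans[OF _ m(1)])
    then have "(\<Sum>i=1..n. w i) = (\<Sum>i=1..m\<^sup>2. w i) + (\<Sum>i\<in>{m\<^sup>2<..n}. w i)"
      by (simp add: sum.union_disjoint disjoint_iff)
    also have "\<bar>\<dots>\<bar> \<le> \<bar>\<Sum>i=1..m\<^sup>2. w i\<bar> + (\<Sum>i\<in>{m\<^sup>2<..n}. \<bar>w i\<bar>)"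
      using sum_abs[of w "{m\<^sup>2<..n}"] by linarith
    also have "\<dots> \<le> \<bar>\<Sum>i=1..m\<^sup>2. w i\<bar> + (\<Sum>i\<in>{m\<^sup>2<..(Suc m)\<^sup>2}. \<bar>w i\<bar>)"
      using m by (intro add_left_mono sum_mono2) auto
    finally have "\<bar>\<Sum>i=1..n. w i\<bar> / real n \<le>
        (\<bar>\<Sum>i=1..m\<^sup>2. w i\<bar> + (\<Sum>i\<in>{m\<^sup>2<..(Suc m)\<^sup>2}. \<bar>w i\<bar>)) / real m ^ 2"
      using m by (intro frac_le add_nonneg_nonneg sum_nonneg) (auto simp flip: of_nat_power)
    then show ?thesis
      by (simp add: a_def m_def add_divide_distrib)
  qed
  then show ?thesis
    by (intro Lim_null_comparison[OF _ lim]) (auto simp: eventually_at_top_linorder)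
qed

text \<open>Integrating termwise, the sum of all squares has finite integral. It is therefore finite
  almost everywhere, and the terms of a convergent series tend to 0.\<close>

lemma AE_tendsto_0_if_summable_second_moments:
  fixes f :: "nat \<Rightarrow> 'a \<Rightarrow> real"
  assumes [measurable]: "\<And>n. f n \<in> borel_measurable M"
    and "summable b" "\<And>n. b n \<ge> 0" "\<And>n. (\<integral>\<^sup>+ x. ennreal ((f n x)\<^sup>2) \<partial>M) \<le> ennreal (b n)"
  shows "AE x in M. (\<lambda>n. f n x) \<longlonglongrightarrow> 0"
proof -
  have "(\<integral>\<^sup>+ x. (\<Sum>n. ennreal ((f n x)\<^sup>2)) \<partial>M) = (\<Sum>n. \<integral>\<^sup>+ x. ennreal ((f n x)\<^sup>2) \<partial>M)"
    by (intro nn_integral_suminf) measurable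
  also have "\<dots> \<le> (\<Sum>n. ennreal (b n))"
    using assms by (intro suminf_le) auto
  also have "\<dots> < \<infinity>"
    using assms by (simp add: ennreal_suminf_neq_top less_top[symmetric])
  finally have "AE x in M. (\<Sum>n. ennreal ((f n x)\<^sup>2)) \<noteq> \<infinity>"
    by (intro nn_integral_PInf_AE) (auto simp: top_unique)
  then show ?thesis
  proof eventually_elim
    case (elim x)
    then have "summable (\<lambda>n. (f n x)\<^sup>2)"
      by (intro summable_suminf_not_top) auto
    then have "(\<lambda>n. (f n x)\<^sup>2) \<longlonglongrightarrow> 0"
      by (rule summable_LIMSEQ_zero)
    from tendsto_real_sqrt[OF this] show "(\<lambda>n. f n x) \<longlonglongrightarrow> 0"
      by (simp add: tendsto_rabs_zero_iff)
  qed
qed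

text \<open>Along the squares the second moments of the averages are summable; between consecutive squares there
  are only \<open>2m + 1\<close> terms, so crude Cauchy--Schwarz suffices there.\<close>

lemma AE_average_tendsto_0_orthogonal:
  fixes W :: "nat \<Rightarrow> 'a \<Rightarrow> real"
  assumes meas [measurable]: "\<And>i. i \<ge> 1 \<Longrightarrow> W i \<in> borel_measurable M"
    and int: "\<And>i. i \<ge> 1 \<Longrightarrow> integrable M (\<lambda>x. (W i x)\<^sup>2)"
    and bound: "\<And>i. i \<ge> 1 \<Longrightarrow> (LINT x|M. (W i x)\<^sup>2) \<le> c"
    and orth_int: "\<And>i j. i \<ge> 1 \<Longrightarrow> j \<ge> 1 \<Longrightarrow> i \<noteq> j \<Longrightarrow> integrable M (\<lambda>x. W i x * W j x)"
    and orth: "\<And>i j. i \<ge> 1 \<Longrightarrow> j \<ge> 1 \<Longrightarrow> i \<noteq> j \<Longrightarrow> (LINT x|M. W i x * W j x) = 0"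
  shows "AE x in M. (\<lambda>n. (\<Sum>i=1..n. W i x) / real n) \<longlonglongrightarrow> 0"
proof -
  have c: "c \<ge> 0"
    by (rule order_trans[OF Bochner_Integration.integral_nonneg bound[of 1]]) auto
  have summ: "summable (\<lambda>m. K * (1 / real m ^ 2))" for K
    using inverse_power_summable[of 2, where 'a=real] by (intro summable_mult) (simp add: inverse_eq_divide)
  have prod_int: "integrable M (\<lambda>x. W i x * W j x)" if "i \<ge> 1" "j \<ge> 1" for i j
    using that orth_int int by (cases "i = j") (auto simp: power2_eq_square)
  have "AE x in M. (\<lambda>m. (\<Sum>i=1..m\<^sup>2. W i x) / real m ^ 2) \<longlonglongrightarrow> 0"
  proof (rule AE_tendsto_0_if_summable_second_moments)
    show "summable (\<lambda>m. c * (1 / real m ^ 2))" by (rule summ)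
    fix m :: nat
    let ?S = "\<lambda>x. \<Sum>i=1..m\<^sup>2. W i x"
    have S2: "(?S x)\<^sup>2 = (\<Sum>i=1..m\<^sup>2. \<Sum>j=1..m\<^sup>2. W i x * W j x)" for x
      by (simp add: power2_eq_square sum_product)
    have "(LINT x|M. (?S x)\<^sup>2) = (\<Sum>i=1..m\<^sup>2. \<Sum>j=1..m\<^sup>2. LINT x|M. W i x * W j x)"
      unfolding S2 using prod_int
      by (subst Bochner_Integration.integral_sum, fastforce intro!: Bochner_Integration.integrable_sum)
        (auto intro!: sum.cong Bochner_Integration.integral_sum)
    \<comment> \<open>Orthogonality leaves only the m^2 diagonal terms, so the second moment of the
      sum is of order m^2 and not m^4. Division by m^4 then gives the summable bound c /
      m^2.\<close>
    also have "\<dots> = (\<Sum>i=1..m\<^sup>2. \<Sum>j=1..m\<^sup>2. if i = j then LINT x|M. (W i x)\<^sup>2 else 0)"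
      by (intro sum.cong refl) (auto simp: orth power2_eq_square)
    also have "\<dots> \<le> (\<Sum>i=1..m\<^sup>2. c)"
      by (intro sum_mono) (auto simp: bound)
    finally have le: "(LINT x|M. (?S x)\<^sup>2) \<le> real m ^ 2 * c"
      by simp
    have int2: "integrable M (\<lambda>x. (?S x)\<^sup>2)"
      unfolding S2 by (intro Bochner_Integration.integrable_sum prod_int) auto
    show "(\<integral>\<^sup>+ x. ennreal ((?S x / real m ^ 2)\<^sup>2) \<partial>M) \<le> ennreal (c * (1 / real m ^ 2))"
    proof -
      have "(\<integral>\<^sup>+ x. ennreal ((?S x / real m ^ 2)\<^sup>2) \<partial>M) = ennreal (LINT x|M. (?S x / real m ^ 2)\<^sup>2)"
        using int2 by (intro nn_integral_eq_integral) (auto simp: power_divide)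
      also have "(LINT x|M. (?S x / real m ^ 2)\<^sup>2) = (LINT x|M. (?S x)\<^sup>2) / real m ^ 4"
        by (simp add: power_divide flip: power_mult)
      also have "\<dots> \<le> (real m ^ 2 * c) / real m ^ 4"
        by (intro divide_right_mono le) auto
      also have "\<dots> = c * (1 / real m ^ 2)"
        \<comment> \<open>At \<open>m = 0\<close> both sides are 0, because division by 0 yields
          0.\<close>
        by (cases "m = 0") (auto simp: field_simps simp flip: power_add)
      finally show ?thesis by (simp add: ennreal_leI)
    qed
  qed (use c in auto)
  moreover have "AE x in M. (\<lambda>m. (\<Sum>i\<in>{m\<^sup>2<..(Suc m)\<^sup>2}. \<bar>W i x\<bar>) / real m ^ 2) \<longlonglongrightarrow> 0"
  proof (rule AE_tendsto_0_if_summable_second_moments)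
    \<comment> \<open>The 9 comes from 2m + 1 \<le> 3m for m \<ge> 1: Cauchy-Schwarz contributes the
      block length once and the sum of second moments contributes it again, and (3m)^2 c / m^4 = 9c
      / m^2.\<close>
    show "summable (\<lambda>m. 9 * c * (1 / real m ^ 2))" by (rule summ)
    fix m :: nat
    let ?I = "{m\<^sup>2<..(Suc m)\<^sup>2}"
    let ?S = "\<lambda>x. \<Sum>i\<in>?I. \<bar>W i x\<bar>"
    let ?k = "2 * real m + 1"
    have card: "real (card ?I) = ?k"
      by (simp add: power2_eq_square)
    have le: "(?S x)\<^sup>2 \<le> ?k * (\<Sum>i\<in>?I. (W i x)\<^sup>2)" for x
      using sum_squared_le_sum_of_squares[of "\<lambda>i. \<bar>W i x\<bar>" ?I] card by (simp add: mult.commute)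
    have intS: "integrable M (\<lambda>x. ?k * (\<Sum>i\<in>?I. (W i x)\<^sup>2) / real m ^ 4)"
      by (intro integrable_divide integrable_mult_right Bochner_Integration.integrable_sum int) auto
    have "(\<integral>\<^sup>+ x. ennreal ((?S x / real m ^ 2)\<^sup>2) \<partial>M)
        \<le> (\<integral>\<^sup>+ x. ennreal (?k * (\<Sum>i\<in>?I. (W i x)\<^sup>2) / real m ^ 4) \<partial>M)"
      using le by (intro nn_integral_mono ennreal_leI)
        (auto simp: power_divide intro!: divide_right_mono simp flip: power_mult)
    also have "\<dots> = ennreal (LINT x|M. ?k * (\<Sum>i\<in>?I. (W i x)\<^sup>2) / real m ^ 4)"
      by (intro nn_integral_eq_integral intS) (auto intro!: divide_nonneg_nonneg mult_nonneg_nonneg sum_nonneg)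
    also have "(LINT x|M. ?k * (\<Sum>i\<in>?I. (W i x)\<^sup>2) / real m ^ 4)
        = ?k * (\<Sum>i\<in>?I. LINT x|M. (W i x)\<^sup>2) / real m ^ 4"
      using int by (subst Bochner_Integration.integral_sum[symmetric]) auto
    also have "\<dots> \<le> ?k * (\<Sum>i\<in>?I. c) / real m ^ 4"
      by (intro divide_right_mono mult_left_mono sum_mono bound) auto
    also have "\<dots> = ?k ^ 2 * c / real m ^ 4"
      using card by (simp add: power2_eq_square)
    also have "\<dots> \<le> 9 * c * (1 / real m ^ 2)"
    proof (cases "m = 0")
      case False
      then have "?k ^ 2 * c \<le> (3 * real m) ^ 2 * c"
        using c by (intro mult_right_mono power_mono) auto
      then have "?k ^ 2 * c / real m ^ 4 \<le> (3 * real m) ^ 2 * c / real m ^ 4"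
        by (intro divide_right_mono) auto
      also have "\<dots> = 9 * c * (1 / real m ^ 2)"
        using False by (auto simp: field_simps power_mult_distrib simp flip: power_add)
      finally show ?thesis .
    qed auto
    finally show "(\<integral>\<^sup>+ x. ennreal ((?S x / real m ^ 2)\<^sup>2) \<partial>M) \<le> ennreal (9 * c * (1 / real m ^ 2))"
      by (simp add: ennreal_leI)
  qed (use c in auto)
  ultimately show ?thesis
    by eventually_elim (rule average_tendsto_0_if_squares)
qed

text \<open>Centering turns independence into orthogonality, as the mean of a product of two
  distinct centered variables factors into 0. It does not increase second moments, so the same
  \<open>c\<close> serves for the centered variables.\<close>

lemma (in prob_space) strong_law_bounded_second_moments:
  fixes X :: "nat \<Rightarrow> 'a \<Rightarrow> real"
  assumes indep: "indep_vars (\<lambda>_. borel) X {1..}"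
    and int2: "\<And>i. i \<ge> 1 \<Longrightarrow> integrable M (\<lambda>x. (X i x)\<^sup>2)"
    and bound: "\<And>i. i \<ge> 1 \<Longrightarrow> expectation (\<lambda>x. (X i x)\<^sup>2) \<le> c"
  shows "AE x in M. (\<lambda>n. (\<Sum>i=1..n. X i x - expectation (X i)) / real n) \<longlonglongrightarrow> 0"
proof (rule AE_average_tendsto_0_orthogonal)
  define W where "W i x = X i x - expectation (X i)" for i x
  have indepW: "indep_vars (\<lambda>_. borel) W {1..}"
    unfolding W_def by (rule indep_vars_compose2[OF indep]) auto
  have meas: "X i \<in> borel_measurable M" if "i \<ge> 1" for i
    using indep that by (auto simp: indep_vars_def)
  have int: "integrable M (X i)" if "i \<ge> 1" for i
    using square_integrable_imp_integrable[OF meas int2] that by simp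
  then have intW: "integrable M (W i)" "expectation (W i) = 0" if "i \<ge> 1" for i
    using that by (auto simp: W_def[abs_def] prob_space)
  fix i :: nat assume i: "i \<ge> 1"
  show "(\<lambda>x. X i x - expectation (X i)) \<in> borel_measurable M"
    using meas[OF i] by simp
  show "integrable M (\<lambda>x. (X i x - expectation (X i))\<^sup>2)"
    using int[OF i] int2[OF i] by (simp add: power2_diff)
  show "(LINT x|M. (X i x - expectation (X i))\<^sup>2) \<le> c"
    using bound[OF i] variance_eq[OF int[OF i] int2[OF i]] by (smt (verit) zero_le_power2)
  fix j :: nat assume j: "j \<ge> 1" "i \<noteq> j"
  have sub: "indep_vars (\<lambda>_. borel) W {i, j}"
    by (rule indep_vars_subset[OF indepW]) (use i j in auto)
  show "integrable M (\<lambda>x. (X i x - expectation (X i)) * (X j x - expectation (X j)))"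
    using indep_vars_integrable[OF _ sub] intW i j by (auto simp: W_def)
  have "(LINT x|M. (\<Prod>k\<in>{i, j}. W k x)) = (\<Prod>k\<in>{i, j}. expectation (W k))"
    by (rule indep_vars_lebesgue_integral[OF _ sub]) (use intW i j in auto)
  then show "(LINT x|M. (X i x - expectation (X i)) * (X j x - expectation (X j))) = 0"
    using intW(2)[OF i] j by (simp add: W_def)
qed

section \<open>Cardinalities of random subsets of a countable set\<close>

lemma ecard_finite: "finite A \<Longrightarrow> ecard A = of_nat (card A)"
  and ecard_infinite: "infinite A \<Longrightarrow> ecard A = \<top>"
  by (simp_all add: ecard_def)

text \<open>Also valid for infinite sets, since \<open>enn2real\<close> sends infinity to 0, the
  value of \<open>card\<close> there. Measurability of \<open>card\<close> thus follows from that of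
  \<open>ecard\<close>.\<close>

lemma card_eq_enn2real_ecard: "real (card A) = enn2real (ecard A)"
  by (cases "finite A") (simp_all add: ecard_finite ecard_infinite flip: ennreal_of_nat_eq_real_of_nat)

lemma card_le_ecard: "ennreal (real (card A)) \<le> ecard A"
  by (cases "finite A") (simp_all add: ecard_finite ecard_infinite ennreal_of_nat_eq_real_of_nat)

lemma ecard_mono: "A \<subseteq> A' \<Longrightarrow> ecard A \<le> ecard A'"
  unfolding ecard_def by (rule emeasure_mono) auto

text \<open>In this form, questions about the measurability and expectation of a random cardinality
  become questions about an iterated integral.\<close>

lemma ecard_eq_nn_integral:
  assumes "A \<subseteq> I"
  shows "ecard A = (\<integral>\<^sup>+ q. indicator A q \<partial>count_space I)"
  using assms by (cases "finite A") (auto simp: ecard_finite ecard_infinite emeasure_count_space)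

text \<open>Countability of \<open>I\<close> makes the membership indicator jointly measurable in
  \<open>q\<close> and \<open>x\<close>, given measurability in \<open>x\<close> for each
  \<open>q\<close>. It also makes the counting measure on \<open>I\<close> sigma-finite, so
  \<open>q\<close> can be integrated out.\<close>

lemma borel_measurable_ecard:
  assumes I: "countable I"
    and meas: "\<And>q. q \<in> I \<Longrightarrow> {x \<in> space N. q \<in> A x} \<in> sets N"
    and sub: "\<And>x. x \<in> space N \<Longrightarrow> A x \<subseteq> I"
  shows "(\<lambda>x. ecard (A x)) \<in> borel_measurable N"
proof -
  interpret I: sigma_finite_measure "count_space I"
    using I by (rule sigma_finite_measure_count_space_countable)
  have "(\<lambda>x. indicator (A x) q :: ennreal) \<in> borel_measurable N" if "q \<in> I" for q
  proof -
    have "(indicator {x \<in> space N. q \<in> A x} :: _ \<Rightarrow> ennreal) \<in> borel_measurable N"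
      using meas[OF that] by simp
    then show ?thesis
      by (subst (asm) measurable_cong[where g="\<lambda>x. indicator (A x) q"]) (auto simp: indicator_def)
  qed
  then have "case_prod (\<lambda>q x. indicator (A x) q :: ennreal) \<in> borel_measurable (count_space I \<Otimes>\<^sub>M N)"
    using I by (intro measurable_pair_measure_countable1) auto
  then have "case_prod (\<lambda>x q. indicator (A x) q :: ennreal) \<in> borel_measurable (N \<Otimes>\<^sub>M count_space I)"
    by (subst (asm) measurable_pair_swap_iff) (simp add: case_prod_beta')
  then have "(\<lambda>x. \<integral>\<^sup>+ q. indicator (A x) q \<partial>count_space I) \<in> borel_measurable N"
    by (rule I.borel_measurable_nn_integral)
  then show ?thesis
    using sub by (subst measurable_cong[OF ecard_eq_nn_integral]) auto
qed

text \<open>Tonelli over the counting measure on \<open>I\<close>, that is, linearity of expectation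
  for countably many membership events.\<close>

lemma nn_integral_ecard:
  assumes I: "countable I"
    and meas: "\<And>q. q \<in> I \<Longrightarrow> {x \<in> space N. q \<in> A x} \<in> sets N"
    and sub: "\<And>x. x \<in> space N \<Longrightarrow> A x \<subseteq> I"
  shows "(\<integral>\<^sup>+ x. ecard (A x) \<partial>N) = (\<integral>\<^sup>+ q. emeasure N {x \<in> space N. q \<in> A x} \<partial>count_space I)"
proof -
  have "(\<integral>\<^sup>+ x. ecard (A x) \<partial>N) = (\<integral>\<^sup>+ x. \<integral>\<^sup>+ q. indicator {x \<in> space N. q \<in> A x} x \<partial>count_space I \<partial>N)"
  proof (intro nn_integral_cong)
    fix x assume x: "x \<in> space N"
    show "ecard (A x) = (\<integral>\<^sup>+ q. indicator {x \<in> space N. q \<in> A x} x \<partial>count_space I)"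
      unfolding ecard_eq_nn_integral[OF sub[OF x]]
      using x by (intro nn_integral_cong) (simp add: indicator_def)
  qed
  also have "\<dots> = (\<integral>\<^sup>+ q. \<integral>\<^sup>+ x. indicator {x \<in> space N. q \<in> A x} x \<partial>N \<partial>count_space I)"
    using meas I by (intro nn_integral_count_space_nn_integral) auto
  also have "\<dots> = (\<integral>\<^sup>+ q. emeasure N {x \<in> space N. q \<in> A x} \<partial>count_space I)"
    using meas by (intro nn_integral_cong) auto
  finally show ?thesis .
qed

lemma borel_measurable_card:
  assumes "countable I"
    and "\<And>q. q \<in> I \<Longrightarrow> {x \<in> space N. q \<in> A x} \<in> sets N"
    and "\<And>x. x \<in> space N \<Longrightarrow> A x \<subseteq> I"
  shows "(\<lambda>x. real (card (A x))) \<in> borel_measurable N"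
  unfolding card_eq_enn2real_ecard
  using borel_measurable_ecard[of I N A] assms by measurable

section \<open>A single research group: measurability and moments of its counts\<close>

text \<open>Fixes one index \<open>i\<close> and collects what is known of that group alone.
  Independence across groups enters only when the groups are put together.\<close>

locale research_group = prob_space M
  for M :: "'w measure" and S :: "'y measure" and \<alpha> B :: real and Q :: "'y question set"
    and F :: "'y measure" and Y :: "'w \<Rightarrow> 'y" and Qhat :: "'y \<Rightarrow> 'y question set"
    and \<phi> :: "'y question \<Rightarrow> 'y \<Rightarrow> real" and Rej :: "'w \<Rightarrow> 'y question set" +
  assumes \<alpha>_nonneg: "0 \<le> \<alpha>" and B_nonneg: "0 \<le> B"
    and countable_Q: "countable Q"
    and Y [measurable]: "Y \<in> measurable M S" and distr_Y: "distr M S Y = F"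
    and selection_rule: "is_selection_rule S Q Qhat"
    and level: "\<And>q. q \<in> Q \<Longrightarrow> selective_level_test \<alpha> S Qhat q (\<phi> q)"
    and rejects: "rejects_according_to M S Q Qhat \<phi> Y Rej"
    and second_moment: "(\<integral>\<^sup>+ y. (ecard (Qhat y))\<^sup>2 \<partial>F) \<le> ennreal B"
begin

abbreviation true_nulls :: "'w \<Rightarrow> 'y question set" where
  "true_nulls \<omega> \<equiv> selected_true_nulls F Qhat (Y \<omega>)"

abbreviation num_nulls :: "'w \<Rightarrow> real" where
  "num_nulls \<omega> \<equiv> real (num_true_nulls F Qhat Y \<omega>)"

abbreviation num_rej :: "'w \<Rightarrow> real" where
  "num_rej \<omega> \<equiv> real (num_false_rejections F Qhat Y Rej \<omega>)"

lemma Qhat_subset: "y \<in> space S \<Longrightarrow> Qhat y \<subseteq> Q"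
  and selection_event_sets [measurable]: "q \<in> Q \<Longrightarrow> selection_event S Qhat q \<in> sets S"
  using selection_rule by (auto simp: is_selection_rule_def)

lemma rej_sets [measurable]: "q \<in> Q \<Longrightarrow> {\<omega> \<in> space M. q \<in> Rej \<omega>} \<in> sets M"
  using rejects by (auto simp: rejects_according_to_def)

lemma null_event_sets:
  assumes "q \<in> Q"
  shows "{y \<in> space S. q \<in> selected_true_nulls F Qhat y} \<in> sets S"
proof -
  have "{y \<in> space S. q \<in> selected_true_nulls F Qhat y} =
      (if F \<in> null_hyp q then selection_event S Qhat q else {})"
    by (auto simp: selected_true_nulls_def selection_event_def)
  then show ?thesis using assms by simp
qed

lemma true_nulls_sets: "q \<in> Q \<Longrightarrow> {\<omega> \<in> space M. q \<in> true_nulls \<omega>} \<in> sets M"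
  using measurable_sets[OF Y null_event_sets, of q] measurable_space[OF Y]
  by (auto simp: vimage_def Int_def conj_commute cong: conj_cong)

lemma true_nulls_subset: "\<omega> \<in> space M \<Longrightarrow> true_nulls \<omega> \<subseteq> Q"
  using Qhat_subset[OF measurable_space[OF Y]] by (auto simp: selected_true_nulls_def)

lemma false_rej_sets: "q \<in> Q \<Longrightarrow> {\<omega> \<in> space M. q \<in> true_nulls \<omega> \<inter> Rej \<omega>} \<in> sets M"
  using sets.Int[OF true_nulls_sets rej_sets, of q q] by (auto simp: Int_def conj_ac elim!: back_subst[of "\<lambda>x. x \<in> sets M"])

lemma measurable_num_nulls [measurable]: "num_nulls \<in> borel_measurable M"
  unfolding num_true_nulls_def
  by (intro borel_measurable_card[OF countable_Q] true_nulls_sets true_nulls_subset)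

lemma measurable_num_rej [measurable]: "num_rej \<in> borel_measurable M"
  unfolding num_false_rejections_def
  using true_nulls_subset by (intro borel_measurable_card[OF countable_Q] false_rej_sets) auto

lemma second_moment_selected: "(\<integral>\<^sup>+ \<omega>. (ecard (Qhat (Y \<omega>)))\<^sup>2 \<partial>M) \<le> ennreal B"
proof -
  have "(\<lambda>y. ecard (Qhat y)) \<in> borel_measurable S"
    using selection_event_sets
    by (intro borel_measurable_ecard[OF countable_Q]) (auto simp: selection_event_def Qhat_subset dest: Qhat_subset)
  then have "(\<integral>\<^sup>+ \<omega>. (ecard (Qhat (Y \<omega>)))\<^sup>2 \<partial>M) = (\<integral>\<^sup>+ y. (ecard (Qhat y))\<^sup>2 \<partial>F)"
    unfolding distr_Y[symmetric] by (subst nn_integral_distr) (auto simp: power2_eq_square)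
  then show ?thesis using second_moment by simp
qed

text \<open>A finite second moment forbids the value infinity with positive probability. Hence the
  convention that \<open>card\<close> is 0 on infinite sets affects only a null event.\<close>

lemma AE_finite_selected: "AE \<omega> in M. finite (Qhat (Y \<omega>))"
proof -
  have [measurable]: "(\<lambda>\<omega>. ecard (Qhat (Y \<omega>))) \<in> borel_measurable M"
  proof (rule borel_measurable_ecard[OF countable_Q])
    fix q assume "q \<in> Q"
    then show "{\<omega> \<in> space M. q \<in> Qhat (Y \<omega>)} \<in> sets M"
      using measurable_sets[OF Y selection_event_sets, of q] measurable_space[OF Y]
      by (auto simp: selection_event_def vimage_def Int_def conj_commute cong: conj_cong)
  qed (use Qhat_subset measurable_space[OF Y] in blast)
  have "(\<integral>\<^sup>+ \<omega>. (ecard (Qhat (Y \<omega>)))\<^sup>2 \<partial>M) \<noteq> \<infinity>"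
    using second_moment_selected by (auto simp: top_unique)
  then have "AE \<omega> in M. (ecard (Qhat (Y \<omega>)))\<^sup>2 \<noteq> \<infinity>"
    by (intro nn_integral_PInf_AE) auto
  then show ?thesis
    by eventually_elim (auto simp: ecard_infinite power2_eq_square ennreal_top_mult intro: ccontr)
qed

text \<open>Treats the true nulls and the false rejections at once: both counts are dominated by the
  number of selected questions.\<close>

lemma square_integrable_if_card:
  assumes [measurable]: "f \<in> borel_measurable M"
    and f: "\<And>\<omega>. ennreal (f \<omega>) \<le> ecard (Qhat (Y \<omega>))" "\<And>\<omega>. f \<omega> \<ge> 0"
  shows "integrable M (\<lambda>\<omega>. (f \<omega>)\<^sup>2)" "expectation (\<lambda>\<omega>. (f \<omega>)\<^sup>2) \<le> B"
proof -
  have "(\<integral>\<^sup>+ \<omega>. ennreal ((f \<omega>)\<^sup>2) \<partial>M) \<le> (\<integral>\<^sup>+ \<omega>. (ecard (Qhat (Y \<omega>)))\<^sup>2 \<partial>M)"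
    using f by (intro nn_integral_mono) (auto simp: power2_eq_square ennreal_mult intro!: mult_mono)
  then have le: "(\<integral>\<^sup>+ \<omega>. ennreal ((f \<omega>)\<^sup>2) \<partial>M) \<le> ennreal B"
    using second_moment_selected by (rule order_trans)
  then show int: "integrable M (\<lambda>\<omega>. (f \<omega>)\<^sup>2)"
    by (intro integrableI_bounded) (auto intro: le_less_trans)
  show "expectation (\<lambda>\<omega>. (f \<omega>)\<^sup>2) \<le> B"
    using le B_nonneg by (simp add: nn_integral_eq_integral[OF int])
qed

lemma num_nulls_le: "ennreal (num_nulls \<omega>) \<le> ecard (Qhat (Y \<omega>))"
  unfolding num_true_nulls_def
  by (rule order_trans[OF card_le_ecard ecard_mono]) (auto simp: selected_true_nulls_def)

lemma num_rej_le: "ennreal (num_rej \<omega>) \<le> ecard (Qhat (Y \<omega>))"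
  unfolding num_false_rejections_def
  by (rule order_trans[OF card_le_ecard ecard_mono]) (auto simp: selected_true_nulls_def)

lemmas num_nulls_square = square_integrable_if_card[OF measurable_num_nulls num_nulls_le, simplified]
lemmas num_rej_square = square_integrable_if_card[OF measurable_num_rej num_rej_le, simplified]

lemma integrable_num_nulls: "integrable M num_nulls"
  by (rule square_integrable_imp_integrable[OF measurable_num_nulls num_nulls_square(1)])

lemma integrable_num_rej: "integrable M num_rej"
  by (rule square_integrable_imp_integrable[OF measurable_num_rej num_rej_square(1)])

lemma AE_num_nulls: "AE \<omega> in M. ennreal (num_nulls \<omega>) = ecard (true_nulls \<omega>)"
  using AE_finite_selected
proof eventually_elim
  case (elim \<omega>)
  then have "finite (true_nulls \<omega>)"
    by (rule finite_subset[rotated]) (auto simp: selected_true_nulls_def)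
  then show ?case
    by (simp add: num_true_nulls_def ecard_finite ennreal_of_nat_eq_real_of_nat)
qed

section \<open>Expected counts of a single group\<close>

text \<open>Selection is determined by the data, so its indicator may be moved inside the
  conditional expectation of the rejection indicator given the data. On the selection event that
  conditional expectation is \<open>\<phi> q\<close>; transferring the integral to \<open>F\<close>
  leaves exactly the quantity bounded by the selective level.\<close>

lemma false_rejection_prob_le:
  assumes q: "q \<in> Q" and null: "F \<in> null_hyp q"
  shows "prob {\<omega> \<in> space M. q \<in> Qhat (Y \<omega>) \<and> q \<in> Rej \<omega>} \<le> \<alpha> * prob {\<omega> \<in> space M. q \<in> Qhat (Y \<omega>)}"
proof -
  define A where "A = selection_event S Qhat q"
  define D where "D = {\<omega> \<in> space M. q \<in> Rej \<omega>}"
  let ?G = "vimage_algebra (space M) Y S"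
  have [measurable]: "A \<in> sets S" "D \<in> sets M" "\<phi> q \<in> borel_measurable S"
    and \<phi>: "\<And>y. y \<in> space S \<Longrightarrow> 0 \<le> \<phi> q y \<and> \<phi> q y \<le> 1"
    using q level by (auto simp: A_def D_def selective_level_test_def is_test_def)
  have A_iff: "\<omega> \<in> space M \<Longrightarrow> Y \<omega> \<in> A \<longleftrightarrow> q \<in> Qhat (Y \<omega>)" for \<omega>
    using measurable_space[OF Y] by (auto simp: A_def selection_event_def)
  have "subalgebra M ?G"
    unfolding subalgebra_def using measurable_sets[OF Y] measurable_space[OF Y]
    by (auto simp: sets_vimage_algebra2)
  then interpret G: finite_measure_subalgebra M ?G
    by unfold_locales
  interpret F: prob_space F
    using prob_space_distr[OF Y] by (simp add: distr_Y)
  have sets_F: "sets F = sets S" and space_F: "space F = space S"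
    by (auto simp flip: distr_Y)
  have meas_A: "measure F A = prob {\<omega> \<in> space M. q \<in> Qhat (Y \<omega>)}"
    unfolding distr_Y[symmetric] by (subst measure_distr) (auto simp: A_iff intro!: arg_cong[of _ _ prob])
  \<comment> \<open>Measurability with respect to the sigma-algebra generated by the data, not
    merely \<open>M\<close>, is what permits the exchange with the conditional expectation.\<close>
  have [measurable]: "(\<lambda>\<omega>. indicator A (Y \<omega>) :: real) \<in> borel_measurable ?G"
    by (rule measurable_compose[OF measurable_vimage_algebra1]) (use measurable_space[OF Y] in auto)
  have "prob {\<omega> \<in> space M. q \<in> Qhat (Y \<omega>) \<and> q \<in> Rej \<omega>} = (LINT \<omega>|M. indicator {\<omega> \<in> space M. Y \<omega> \<in> A \<and> \<omega> \<in> D} \<omega>)"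
    using A_iff by (auto simp: D_def intro!: arg_cong[of _ _ prob])
  also have "\<dots> = (LINT \<omega>|M. indicator A (Y \<omega>) * indicator D \<omega>)"
    by (intro Bochner_Integration.integral_cong) (auto simp: indicator_def)
  also have "\<dots> = (LINT \<omega>|M. indicator A (Y \<omega>) * real_cond_exp M ?G (indicator D) \<omega>)"
  proof (rule G.real_cond_exp_intg(2)[symmetric])
    show "integrable M (\<lambda>\<omega>. indicator A (Y \<omega>) * indicator D \<omega> :: real)"
      by (rule integrable_const_bound[where B=1]) (auto simp: indicator_def)
  qed measurable
  also have "\<dots> = (LINT \<omega>|M. indicator A (Y \<omega>) * \<phi> q (Y \<omega>))"
  proof (intro integral_cong_AE)
    \<comment> \<open>The rejection probability is prescribed only where \<open>q\<close> is
      selected; elsewhere the indicator of \<open>A\<close> makes both integrands 0.\<close>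
    have "AE \<omega> in M. q \<in> Qhat (Y \<omega>) \<longrightarrow> real_cond_exp M ?G (indicator D) \<omega> = \<phi> q (Y \<omega>)"
      using rejects q by (auto simp: rejects_according_to_def D_def)
    then show "AE \<omega> in M. indicator A (Y \<omega>) * real_cond_exp M ?G (indicator D) \<omega> = indicator A (Y \<omega>) * \<phi> q (Y \<omega>)"
      using AE_space by eventually_elim (auto simp: A_iff indicator_def)
  qed measurable
  also have "\<dots> = (LINT y:A|F. \<phi> q y)"
    unfolding distr_Y[symmetric] set_lebesgue_integral_def by (subst integral_distr) auto
  also have "\<dots> \<le> \<alpha> * measure F A"
  proof (cases "measure F A > 0")
    case True
    then have "(LINT y:A|F. \<phi> q y) / measure F A \<le> \<alpha>"
      using level[OF q] null unfolding selective_level_test_def event_cond_exp_def A_def by auto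
    then show ?thesis using True by (simp add: field_simps)
  next
    \<comment> \<open>The level condition is silent about \<open>F\<close> if the selection event
      has probability 0, but then both sides are 0.\<close>
    case False
    then have "A \<in> null_sets F"
      using F.emeasure_eq_measure[of A] measure_nonneg[of F A] by (auto simp: null_sets_def sets_F)
    then have "AE y in F. indicator A y *\<^sub>R \<phi> q y = 0"
      by (rule AE_mp[OF AE_not_in]) (auto simp: indicator_def)
    then show ?thesis
      using False measure_nonneg[of F A] by (simp add: set_lebesgue_integral_def integral_eq_zero_AE)
  qed
  finally show ?thesis by (simp add: meas_A)
qed

text \<open>Both expectations are sums of membership probabilities over the questions and are
  compared term by term; a question whose null is false contributes 0 to each. Only expectations
  occur, so the dependence between rejections within a group has no influence.\<close>

lemma expectation_num_rej_le: "expectation num_rej \<le> \<alpha> * expectation num_nulls"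
proof -
  have "(\<integral>\<^sup>+ \<omega>. ennreal (num_rej \<omega>) \<partial>M) \<le> (\<integral>\<^sup>+ \<omega>. ecard (true_nulls \<omega> \<inter> Rej \<omega>) \<partial>M)"
    \<comment> \<open>Here an upper bound by \<open>ecard\<close> suffices. At the other end of the
      chain \<open>ecard\<close> must be turned back into \<open>card\<close>, which needs the
      almost sure equality \<open>AE_num_nulls\<close>.\<close>
    unfolding num_false_rejections_def by (intro nn_integral_mono card_le_ecard)
  also have "\<dots> = (\<integral>\<^sup>+ q. emeasure M {\<omega> \<in> space M. q \<in> true_nulls \<omega> \<inter> Rej \<omega>} \<partial>count_space Q)"
    using true_nulls_subset by (intro nn_integral_ecard[OF countable_Q] false_rej_sets) auto
  also have "\<dots> \<le> (\<integral>\<^sup>+ q. ennreal \<alpha> * emeasure M {\<omega> \<in> space M. q \<in> true_nulls \<omega>} \<partial>count_space Q)"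
  proof (intro nn_integral_mono)
    fix q assume "q \<in> space (count_space Q)"
    then have q: "q \<in> Q" by simp
    show "emeasure M {\<omega> \<in> space M. q \<in> true_nulls \<omega> \<inter> Rej \<omega>}
        \<le> ennreal \<alpha> * emeasure M {\<omega> \<in> space M. q \<in> true_nulls \<omega>}"
    proof (cases "F \<in> null_hyp q")
      case True
      then show ?thesis
        using false_rejection_prob_le[OF q True] \<alpha>_nonneg
        by (simp add: selected_true_nulls_def emeasure_eq_measure ennreal_leI flip: ennreal_mult)
    qed (simp add: selected_true_nulls_def)
  qed
  also have "\<dots> = ennreal \<alpha> * (\<integral>\<^sup>+ q. emeasure M {\<omega> \<in> space M. q \<in> true_nulls \<omega>} \<partial>count_space Q)"
    by (intro nn_integral_cmult) auto
  also have "\<dots> = ennreal \<alpha> * (\<integral>\<^sup>+ \<omega>. ecard (true_nulls \<omega>) \<partial>M)"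
    by (intro arg_cong2[where f="(*)"] refl nn_integral_ecard[symmetric] countable_Q true_nulls_sets true_nulls_subset)
  also have "\<dots> = ennreal \<alpha> * (\<integral>\<^sup>+ \<omega>. ennreal (num_nulls \<omega>) \<partial>M)"
    using AE_num_nulls by (intro arg_cong2[where f="(*)"] refl nn_integral_cong_AE) auto
  finally show ?thesis
    using \<alpha>_nonneg
    by (simp add: nn_integral_eq_integral integrable_num_nulls integrable_num_rej
        integral_nonneg_AE flip: ennreal_mult)
qed

text \<open>Almost surely the count dominates the indicator of the event that some true null is
  selected. This converts the assumption on \<delta> into a lower bound for the mean.\<close>

lemma expectation_num_nulls_ge:
  "measure F {y \<in> space S. \<exists>q \<in> Qhat y. F \<in> null_hyp q} \<le> expectation num_nulls"
proof -
  define E where "E = {y \<in> space S. \<exists>q \<in> Qhat y. F \<in> null_hyp q}"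
  have "E = (\<Union>q\<in>Q. {y \<in> space S. q \<in> selected_true_nulls F Qhat y})"
    using Qhat_subset by (auto simp: E_def selected_true_nulls_def)
  then have E [measurable]: "E \<in> sets S"
    using countable_Q null_event_sets by auto
  have "measure F E = prob (Y -` E \<inter> space M)"
    unfolding distr_Y[symmetric] by (intro measure_distr) auto
  also have "\<dots> = expectation (indicator (Y -` E \<inter> space M))"
    by (simp add: Int_assoc)
  also have "\<dots> \<le> expectation num_nulls"
  proof (rule integral_mono_AE[OF _ integrable_num_nulls])
    show "integrable M (indicator (Y -` E \<inter> space M) :: 'w \<Rightarrow> real)"
      by (auto intro!: integrable_const_bound[where B=1] simp: indicator_def)
    show "AE \<omega> in M. indicator (Y -` E \<inter> space M) \<omega> \<le> num_nulls \<omega>"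
      \<comment> \<open>On an infinite set of true nulls \<open>card\<close> would be 0 and the
        lower bound 1 would fail, hence the restriction to almost all outcomes.\<close>
      using AE_finite_selected
    proof eventually_elim
      case (elim \<omega>)
      then have fin: "finite (true_nulls \<omega>)"
        by (rule finite_subset[rotated]) (auto simp: selected_true_nulls_def)
      have "real (card (true_nulls \<omega>)) \<ge> 1" if "Y \<omega> \<in> E"
      proof -
        have "true_nulls \<omega> \<noteq> {}"
          using that unfolding E_def selected_true_nulls_def by blast
        then show ?thesis using fin by (simp add: Suc_leI card_gt_0_iff)
      qed
      then show ?case by (auto simp: indicator_def num_true_nulls_def)
    qed
  qed
  finally show ?thesis by (simp add: E_def)
qed

section \<open>The counts as measurable functions of the group outcome\<close>

text \<open>Independence is assumed for the group outcomes, so the counts inherit it once they are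
  written as fixed measurable functions of the outcome.\<close>

definition nulls_of :: "'y \<times> ('y question \<Rightarrow> bool) \<Rightarrow> real" where
  "nulls_of z = real (card (selected_true_nulls F Qhat (fst z)))"

text \<open>The rejection indicators in an outcome carry information only for questions in
  \<open>Q\<close>, hence the intersection with \<open>Q\<close>. Nothing is lost, as selected
  questions lie in \<open>Q\<close>.\<close>

definition rejections_of :: "'y \<times> ('y question \<Rightarrow> bool) \<Rightarrow> real" where
  "rejections_of z = real (card (selected_true_nulls F Qhat (fst z) \<inter> {q \<in> Q. snd z q}))"

lemma nulls_of_outcome: "nulls_of (group_outcome Q Y Rej \<omega>) = num_nulls \<omega>"
  by (simp add: nulls_of_def group_outcome_def num_true_nulls_def)

lemma rejections_of_outcome:
  assumes "\<omega> \<in> space M"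
  shows "rejections_of (group_outcome Q Y Rej \<omega>) = num_rej \<omega>"
proof -
  have "true_nulls \<omega> \<inter> {q \<in> Q. (\<lambda>q\<in>Q. q \<in> Rej \<omega>) q} = true_nulls \<omega> \<inter> Rej \<omega>"
    using true_nulls_subset[OF assms] by auto
  then show ?thesis by (simp add: rejections_of_def group_outcome_def num_false_rejections_def)
qed

lemma nulls_of_sets:
  assumes "q \<in> Q"
  shows "{z \<in> space (group_space S Q). q \<in> selected_true_nulls F Qhat (fst z)} \<in> sets (group_space S Q)"
proof -
  have "fst \<in> measurable (group_space S Q) S"
    by (simp add: group_space_def)
  from measurable_sets[OF this null_event_sets[OF assms]] show ?thesis
    by (auto simp: group_space_def space_pair_measure elim!: back_subst[of "\<lambda>x. x \<in> _"])
qed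

lemma nulls_of_subset: "z \<in> space (group_space S Q) \<Longrightarrow> selected_true_nulls F Qhat (fst z) \<subseteq> Q"
  using Qhat_subset[of "fst z"] by (auto simp: group_space_def space_pair_measure selected_true_nulls_def)

lemma measurable_nulls_of: "nulls_of \<in> borel_measurable (group_space S Q)"
  unfolding nulls_of_def
  by (intro borel_measurable_card[OF countable_Q] nulls_of_sets nulls_of_subset)

lemma measurable_rejections_of: "rejections_of \<in> borel_measurable (group_space S Q)"
  unfolding rejections_of_def
proof (intro borel_measurable_card[OF countable_Q])
  fix q assume q: "q \<in> Q"
  have "(\<lambda>z. snd z q) \<in> measurable (group_space S Q) (count_space UNIV)"
    unfolding group_space_def
    by (rule measurable_compose[OF measurable_snd measurable_component_singleton[OF q]])
  then have "{z \<in> space (group_space S Q). snd z q} \<in> sets (group_space S Q)"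
    by (simp add: pred_def)
  from sets.Int[OF nulls_of_sets[OF q] this]
  show "{z \<in> space (group_space S Q). q \<in> selected_true_nulls F Qhat (fst z) \<inter> {q \<in> Q. snd z q}}
      \<in> sets (group_space S Q)"
    using q by (auto elim!: back_subst[of "\<lambda>x. x \<in> _"])
qed (use nulls_of_subset in auto)

end

section \<open>From averages to the limsup of the ratio\<close>

text \<open>The deterministic end of the argument, for one fixed outcome: \<open>er\<close> stands
  for the means of \<open>r\<close>, and \<open>ez\<close> for those of
  \<open>v - \<alpha> * r\<close>.\<close>

lemma limsup_ratio_le:
  fixes v r ez er :: "nat \<Rightarrow> real"
  assumes \<delta>: "\<delta> > 0" and er: "\<And>i. i \<ge> 1 \<Longrightarrow> \<delta> \<le> er i" and ez: "\<And>i. i \<ge> 1 \<Longrightarrow> ez i \<le> 0"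
    and lim_z: "(\<lambda>n. (\<Sum>i=1..n. v i - \<alpha> * r i - ez i) / real n) \<longlonglongrightarrow> 0"
    and lim_r: "(\<lambda>n. (\<Sum>i=1..n. r i - er i) / real n) \<longlonglongrightarrow> 0"
  shows "limsup (\<lambda>n. ereal ((\<Sum>i=1..n. v i) / (\<Sum>i=1..n. r i))) \<le> ereal \<alpha>"
proof (rule ereal_le_epsilon2)
  fix \<epsilon> :: real assume \<epsilon>: "\<epsilon> > 0"
  \<comment> \<open>The tolerance \<epsilon> \<delta> / 2 fits the next one: the sum of
    \<open>r\<close> eventually exceeds n \<delta> / 2, so an excess of n \<epsilon> \<delta> / 2 in
    the numerator is less than \<epsilon> times the denominator.\<close>
  have "\<forall>\<^sub>F n in sequentially. (\<Sum>i=1..n. v i - \<alpha> * r i - ez i) / real n < \<epsilon> * \<delta> / 2"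
    by (rule order_tendstoD(2)[OF lim_z]) (use \<epsilon> \<delta> in simp)
  moreover have "\<forall>\<^sub>F n in sequentially. - \<delta> / 2 < (\<Sum>i=1..n. r i - er i) / real n"
    by (rule order_tendstoD(1)[OF lim_r]) (use \<delta> in simp)
  ultimately have "\<forall>\<^sub>F n in sequentially. ereal ((\<Sum>i=1..n. v i) / (\<Sum>i=1..n. r i)) \<le> ereal \<alpha> + ereal \<epsilon>"
    using eventually_gt_at_top[of 0]
  proof eventually_elim
    case (elim n)
    have "(\<Sum>i=1..n. er i) \<ge> (\<Sum>i=1..n. \<delta>)"
      by (intro sum_mono er) auto
    then have r: "(\<Sum>i=1..n. r i) > real n * \<delta> / 2"
      using elim by (simp add: sum_subtractf field_simps)
    have "(\<Sum>i=1..n. ez i) \<le> 0"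
      by (intro sum_nonpos ez) auto
    then have "(\<Sum>i=1..n. v i) - \<alpha> * (\<Sum>i=1..n. r i) < \<epsilon> * (real n * \<delta> / 2)"
      using elim by (simp add: sum_subtractf sum.distrib sum_distrib_left[symmetric] field_simps)
    also have "\<dots> < \<epsilon> * (\<Sum>i=1..n. r i)"
      using r \<epsilon> by simp
    finally have "(\<Sum>i=1..n. v i) < (\<alpha> + \<epsilon>) * (\<Sum>i=1..n. r i)"
      by (simp add: algebra_simps)
    moreover have "(\<Sum>i=1..n. r i) > 0"
      using r \<delta> by (intro le_less_trans[OF _ r]) auto
    ultimately show ?case
      by (simp add: pos_divide_le_eq)
  qed
  then show "limsup (\<lambda>n. ereal ((\<Sum>i=1..n. v i) / (\<Sum>i=1..n. r i))) \<le> ereal \<alpha> + ereal \<epsilon>"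
    by (rule Limsup_bounded)
qed

theorem proposition1:
  fixes M :: "'w measure" and S :: "'y measure"
    and \<alpha> \<delta> B :: real
    and Q :: "'y question set"
    and F :: "nat \<Rightarrow> 'y measure"
    and Y :: "nat \<Rightarrow> 'w \<Rightarrow> 'y"
    and Qhat :: "nat \<Rightarrow> 'y \<Rightarrow> 'y question set"
    and \<phi> :: "nat \<Rightarrow> 'y question \<Rightarrow> 'y \<Rightarrow> real"
    and Rej :: "nat \<Rightarrow> 'w \<Rightarrow> 'y question set"
  assumes "prob_space M"
    and "0 < \<alpha>" "\<alpha> < 1"
    and "countable Q" "\<And>q. q \<in> Q \<Longrightarrow> is_question S q"
    and "\<And>i. i \<ge> 1 \<Longrightarrow> Y i \<in> measurable M S"
    and "\<And>i. i \<ge> 1 \<Longrightarrow> distr M S (Y i) = F i"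
    and "\<And>i. i \<ge> 1 \<Longrightarrow> is_selection_rule S Q (Qhat i)"
    and "\<And>i q. i \<ge> 1 \<Longrightarrow> q \<in> Q \<Longrightarrow> selective_level_test \<alpha> S (Qhat i) q (\<phi> i q)"
    and "\<And>i. i \<ge> 1 \<Longrightarrow> rejects_according_to M S Q (Qhat i) (\<phi> i) (Y i) (Rej i)"
    and "prob_space.indep_vars M (\<lambda>i. group_space S Q) (\<lambda>i. group_outcome Q (Y i) (Rej i)) {1..}"
    and "\<delta> > 0"
    and "\<And>i. i \<ge> 1 \<Longrightarrow>
           measure (F i) {y \<in> space S. \<exists>q \<in> Qhat i y. F i \<in> null_hyp q} \<ge> \<delta>"
    and "\<And>i. i \<ge> 1 \<Longrightarrow> (\<integral>\<^sup>+ y. (ecard (Qhat i y))\<^sup>2 \<partial>F i) \<le> ennreal B"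
  shows "AE \<omega> in M.
           limsup (\<lambda>n. ereal ((\<Sum>i=1..n. real (num_false_rejections (F i) (Qhat i) (Y i) (Rej i) \<omega>)) /
                              (\<Sum>i=1..n. real (num_true_nulls (F i) (Qhat i) (Y i) \<omega>))))
             \<le> ereal \<alpha>"
proof -
  interpret prob_space M by fact
  \<comment> \<open>The sign of \<open>B\<close> is not given. For negative \<open>B\<close> the
    bound \<open>ennreal B\<close> is 0, so \<open>max 0 B\<close> is a valid bound in every
    case.\<close>
  have group: "research_group M S \<alpha> (max 0 B) Q (F i) (Y i) (Qhat i) (\<phi> i) (Rej i)" if "i \<ge> 1" for i
  proof unfold_locales
    show "(\<integral>\<^sup>+ y. (ecard (Qhat i y))\<^sup>2 \<partial>F i) \<le> ennreal (max 0 B)"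
      using assms(14)[OF that] by (cases "B \<ge> 0") (auto simp: max_def ennreal_neg)
  qed (use assms that in auto)
  define R where "R i = research_group.nulls_of (F i) (Qhat i) \<circ> group_outcome Q (Y i) (Rej i)" for i
  define V where "V i = research_group.rejections_of Q (F i) (Qhat i) \<circ> group_outcome Q (Y i) (Rej i)" for i
  \<comment> \<open>The level of the tests is encoded in the sign of one mean: that of
    \<open>Z i\<close> is nonpositive.\<close>
  define Z where "Z i \<omega> = V i \<omega> - \<alpha> * R i \<omega>" for i \<omega>
  have R: "R i \<omega> = real (num_true_nulls (F i) (Qhat i) (Y i) \<omega>)" if "i \<ge> 1" for i \<omega>
    using research_group.nulls_of_outcome[OF group[OF that]] by (simp add: R_def)
  have V: "V i \<omega> = real (num_false_rejections (F i) (Qhat i) (Y i) (Rej i) \<omega>)"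
    if "i \<ge> 1" "\<omega> \<in> space M" for i \<omega>
    using research_group.rejections_of_outcome[OF group[OF that(1)] that(2)] by (simp add: V_def)

  have R_eq: "R i = (\<lambda>\<omega>. real (num_true_nulls (F i) (Qhat i) (Y i) \<omega>))" if "i \<ge> 1" for i
    using R[OF that] by blast
  have R_int: "integrable M (R i)" and R2_int: "integrable M (\<lambda>\<omega>. (R i \<omega>)\<^sup>2)"
    and R2_le: "expectation (\<lambda>\<omega>. (R i \<omega>)\<^sup>2) \<le> max 0 B" and R_ge: "\<delta> \<le> expectation (R i)" if "i \<ge> 1" for i
    using research_group.integrable_num_nulls[OF group[OF that]]
      research_group.num_nulls_square[OF group[OF that]]
      research_group.expectation_num_nulls_ge[OF group[OF that]] assms(13)[OF that]
    by (simp_all add: R_eq[OF that])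
  have V_int: "integrable M (V i)" and V2_int: "integrable M (\<lambda>\<omega>. (V i \<omega>)\<^sup>2)"
    and V2_le: "expectation (\<lambda>\<omega>. (V i \<omega>)\<^sup>2) \<le> max 0 B"
    and V_le: "expectation (V i) \<le> \<alpha> * expectation (R i)" if "i \<ge> 1" for i
    using research_group.integrable_num_rej[OF group[OF that]]
      research_group.num_rej_square[OF group[OF that]]
      research_group.expectation_num_rej_le[OF group[OF that]]
    by (simp_all add: R_eq[OF that] V[OF that] cong: Bochner_Integration.integrable_cong Bochner_Integration.integral_cong)

  have indep_R: "indep_vars (\<lambda>_. borel) R {1..}"
    unfolding R_def using research_group.measurable_nulls_of[OF group]
    by (intro indep_vars_compose[OF assms(11)]) auto
  have indep_Z: "indep_vars (\<lambda>_. borel) Z {1..}"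
  proof -
    have Z: "Z = (\<lambda>i \<omega>. (\<lambda>z. research_group.rejections_of Q (F i) (Qhat i) z -
        \<alpha> * research_group.nulls_of (F i) (Qhat i) z) (group_outcome Q (Y i) (Rej i) \<omega>))"
      by (simp add: fun_eq_iff Z_def V_def R_def)
    show ?thesis
      unfolding Z using research_group.measurable_nulls_of[OF group] research_group.measurable_rejections_of[OF group]
      by (intro indep_vars_compose2[OF assms(11)] borel_measurable_diff borel_measurable_times) auto
  qed
  have Z2_int: "integrable M (\<lambda>\<omega>. (Z i \<omega>)\<^sup>2)" and Z2_le: "expectation (\<lambda>\<omega>. (Z i \<omega>)\<^sup>2) \<le> 2 * max 0 B"
    if i: "i \<ge> 1" for i
  proof -
    \<comment> \<open>Both counts are nonnegative, so the cross term in the square only helps, and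
      \<alpha> < 1 lets the factor \<alpha>^2 be dropped.\<close>
    have le: "(Z i \<omega>)\<^sup>2 \<le> (V i \<omega>)\<^sup>2 + (R i \<omega>)\<^sup>2" if "\<omega> \<in> space M" for \<omega>
    proof -
      have "(\<alpha> * R i \<omega>)\<^sup>2 \<le> (R i \<omega>)\<^sup>2"
        using assms(2,3) by (simp add: power_mult_distrib mult_left_le_one_le power_le_one)
      moreover have "V i \<omega> * (\<alpha> * R i \<omega>) \<ge> 0"
        using assms(2) by (simp add: V[OF i that] R[OF i])
      ultimately show ?thesis unfolding Z_def power2_diff by linarith
    qed
    have [measurable]: "Z i \<in> borel_measurable M"
      using indep_Z i by (auto simp: indep_vars_def)
    show int: "integrable M (\<lambda>\<omega>. (Z i \<omega>)\<^sup>2)"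
      by (rule Bochner_Integration.integrable_bound[OF Bochner_Integration.integrable_add[OF V2_int[OF i] R2_int[OF i]]])
        (use le in auto)
    have "expectation (\<lambda>\<omega>. (Z i \<omega>)\<^sup>2) \<le> expectation (\<lambda>\<omega>. (V i \<omega>)\<^sup>2 + (R i \<omega>)\<^sup>2)"
      using le V2_int[OF i] R2_int[OF i] int by (intro integral_mono) auto
    also have "\<dots> = expectation (\<lambda>\<omega>. (V i \<omega>)\<^sup>2) + expectation (\<lambda>\<omega>. (R i \<omega>)\<^sup>2)"
      using V2_int[OF i] R2_int[OF i] by simp
    finally show "expectation (\<lambda>\<omega>. (Z i \<omega>)\<^sup>2) \<le> 2 * max 0 B"
      using V2_le[OF i] R2_le[OF i] by linarith
  qed
  have Z_nonpos: "expectation (Z i) \<le> 0" if "i \<ge> 1" for i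
    using V_int[OF that] R_int[OF that] V_le[OF that] by (simp add: Z_def[abs_def])

  have "AE \<omega> in M. (\<lambda>n. (\<Sum>i=1..n. Z i \<omega> - expectation (Z i)) / real n) \<longlonglongrightarrow> 0"
    by (rule strong_law_bounded_second_moments[OF indep_Z Z2_int Z2_le])
  moreover have "AE \<omega> in M. (\<lambda>n. (\<Sum>i=1..n. R i \<omega> - expectation (R i)) / real n) \<longlonglongrightarrow> 0"
    by (rule strong_law_bounded_second_moments[OF indep_R R2_int R2_le])
  ultimately show ?thesis
    \<comment> \<open>\<open>V\<close> was identified with the number of false rejections for
      outcomes in \<open>space M\<close>.\<close>
    using AE_space
  proof eventually_elim
    case (elim \<omega>)
    have "limsup (\<lambda>n. ereal ((\<Sum>i=1..n. V i \<omega>) / (\<Sum>i=1..n. R i \<omega>))) \<le> ereal \<alpha>"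
      using limsup_ratio_le[OF assms(12) R_ge Z_nonpos] elim by (simp add: Z_def)
    then show ?case
      using V[OF _ elim(3)] R by simp
  qed
qed

end
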